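(* Let $(M,d)$ be a metric space and let $X,Y\subseteq M$. Assume that there exists $a\in]0,+\infty[$ such that for each $\rho\in]0,a[$ and each $x'\in X$ there exists $x''\in X$ with $d(x',x'')=\rho$. Let \[ \upsilon_Y\in]0,+\infty[,\quad \beta\in]0,1],\quad s_2\in[\beta,+\infty[,\quad s_3\in]0,1]. \] Let $\mathcal{N}$ be a $\sigma$-algebra of subsets of $Y$ containing the Borel subsets of $Y$, and let $\nu$ be a measure on $\mathcal{N}$ with $\nu(Y)<+\infty$. Let $Z\in\mathcal{K}_{\upsilon_Y,s_2,s_3}(X\times Y)$. Then $Z(x,\cdot)$ is $\nu$-integrable in $Y\setminus B(x,r)$ for all $(x,r)\in X\times]0,+\infty[$, and the following statements hold. (i) Let $s_2-\beta>\upsilon_Y$ and $s_2<\upsilon_Y+\beta+s_3$. Let $Y$ be upper $\upsilon_Y$-Ahlfors regular with respect to $X$. If the linear map from $C^{0,\beta}(X\cup Y)$ to $C_b^{0,\min\{\beta,\upsilon_Y+s_3+\beta-s_2\}}(X)$ that takes $g$ to $Q[Z,g,1]$ is continuous, then \[ \sup_{x\in X}\ \sup_{r\in]0,e^{-1/s_3}[}\left|\int_{Y\setminus B(x,r)}Z(x,y)\,d\nu(y)\right|\frac{r^\beta}{\max\{r^\beta,r^{\upsilon_Y+s_3+\beta-s_2}\}}<+\infty. \] In particular, if $s_2\leq\upsilon_Y+s_3$, then $\min\{\beta,\upsilon_Y+s_3+\beta-s_2\}=\beta$ and \[ (\ast)\qquad \sup_{x\in X}\ \sup_{r\in]0,+\infty[}\left|\int_{Y\setminus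 B(x,r)}Z(x,y)\,d\nu(y)\right|<+\infty . \] (ii) Let $s_2-\beta=\upsilon_Y$. Let $Y$ be strongly upper $\upsilon_Y$-Ahlfors regular with respect to $X$. If the linear map from $C^{0,\beta}(X\cup Y)$ to $C_b^{0,\max\{r^\beta,\omega_{s_3}(r)\}}(X)$ that takes $g$ to $Q[Z,g,1]$ is continuous, then \[ \sup_{x\in X}\ \sup_{r\in]0,e^{-1/s_3}[}\left|\int_{Y\setminus B(x,r)}Z(x,y)\,d\nu(y)\right|\frac{r^\beta}{\max\{r^\beta,\omega_{s_3}(r)\}}<+\infty. \] In particular, if $s_3>\beta$, then $C_b^{0,\max\{r^\beta,\omega_{s_3}(r)\}}(X)=C_b^{0,\beta}(X)$ and inequality $(\ast)$ holds true. (iii) Let $s_2-\beta<\upsilon_Y$. Let $Y$ be upper $\upsilon_Y$-Ahlfors regular with respect to $X$. If the linear map from $C^{0,\beta}(X\cup Y)$ to $C_b^{0,\min\{\beta,s_3\}}(X)$ that takes $g$ to $Q[Z,g,1]$ is continuous, then \[ \sup_{x\in X}\ \sup_{r\in]0,e^{-1/s_3}[}\left|\int_{Y\setminus B(x,r)}Z(x,y)\,d\nu(y)\right|\frac{r^\beta}{\max\{r^\beta,r^{s_3}\}}<+\infty. \] In particular, if $s_3\geq\beta$, then $C_b^{0,\min\{\beta,s_3\}}(X)=C_b^{0,\beta}(X)$ and inequality $(\ast)$ holds true.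
   Context: Notation: $]a,b[$ denotes an open interval (similarly for half-open ones). $B(\xi,r)=\{\eta\in M: d(\xi,\eta)<r\}$ for $r>0$, and $B(x,0)=\emptyset$. Ahlfors regularity. $Y$ is upper $\upsilon_Y$-Ahlfors regular with respect to $X$ if there exist $r_{X,Y,\upsilon_Y}\in]0,+\infty]$ and $c_{X,Y,\upsilon_Y}\in]0,+\infty[$ such that $\nu(B(x,r)\cap Y)\leq c_{X,Y,\upsilon_Y}r^{\upsilon_Y}$ for all $x\in X$ and $r\in]0,r_{X,Y,\upsilon_Y}[$. $Y$ is strongly upper $\upsilon_Y$-Ahlfors regular with respect to $X$ if there exist $r_{X,Y,\upsilon_Y}\in]0,+\infty]$ and $c_{X,Y,\upsilon_Y}\in]0,+\infty[$ such that $\nu((B(x,r_2)\setminus B(x,r_1))\cap Y)\leq c_{X,Y,\upsilon_Y}(r_2^{\upsilon_Y}-r_1^{\upsilon_Y})$ for all $x\in X$ and $r_1,r_2\in[0,r_{X,Y,\upsilon_Y}[$ with $r_1<r_2$. Kernels. Let $D_{X\times Y}=\{(x,y)\in X\times Y: x=y\}$. For $s_1,s_2,s_3\in\mathbb{R}$, $\mathcal{K}_{s_1,s_2,s_3}(X\times Y)$ is the set of continuous functions $K:(X\times Y)\setminus D_{X\times Y}\to\mathbb{C}$ such that \[ \sup_{(x,y)\in X\times Y,\,x\neq y}d(x,y)^{s_1}|K(x,y)|+\sup\left\{\frac{d(x',y)^{s_2}}{d(x',x'')^{s_3}}|K(x',y)-K(x'',y)|:\ x',x''\in X,\ x'\neq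 x'',\ y\in Y\setminus B(x',2d(x',x''))\right\}<+\infty . \] Operator. For a function $g:X\cup Y\to\mathbb{C}$, \[ Q[Z,g,1](x)=\int_Y Z(x,y)(g(x)-g(y))\,d\nu(y)\qquad\forall x\in X . \] (The integrand is undefined at most at $y=x$, and $\nu(\{x\})=0$ for $x\in X\cap Y$ under upper Ahlfors regularity.) Hölder spaces. Let $\omega:[0,+\infty[\to[0,+\infty[$ be increasing with $\omega(0)=0$, $\omega(r)>0$ for $r>0$, $\lim_{r\to0^+}\omega(r)=0$ and $\sup_{(a,t)\in[1,+\infty[\times]0,+\infty[}\frac{\omega(at)}{a\,\omega(t)}<+\infty$. For $\mathbb{D}\subseteq M$ and $f:\mathbb{D}\to\mathbb{C}$ set $|f:\mathbb{D}|_{\omega(\cdot)}=\sup\{|f(x)-f(y)|/\omega(d(x,y)): x,y\in\mathbb{D},\,x\neq y\}$. $C^{0,\omega(\cdot)}(\mathbb{D})$ is the space of $f$ with $|f:\mathbb{D}|_{\omega(\cdot)}<\infty$, endowed with this semi-norm (functions in it need not be bounded). $C_b^{0,\omega(\cdot)}(\mathbb{D})$ is the subspace of bounded functions with the norm $\sup_{\mathbb{D}}|f|+|f:\mathbb{D}|_{\omega(\cdot)}$. When $\omega(r)=r^\alpha$ with $\alpha\in]0,1]$, one writes $C^{0,\alpha}$ and $C_b^{0,\alpha}$. Equality of two such spaces is understood with equivalent norms. For $\theta\in]0,1]$, with $r_\theta=e^{-1/\theta}$: $\omega_\theta(0)=0$, $\omega_\theta(r)=r^\theta|\ln r|$ for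 $r\in]0,r_\theta]$, and $\omega_\theta(r)=r_\theta^\theta|\ln r_\theta|$ for $r>r_\theta$. *)

theory Defs
  imports "HOL-Analysis.Analysis"
begin

text \<open>
  The ambient metric space is a type of class \<open>metric_space\<close>. Suprema of nonnegative quantities are
  taken in \<open>ennreal\<close>, so that "\<open>sup < +\<infinity>\<close>" is literally \<open>< top\<close> and the supremum of the
  empty set is 0. A function on a subset \<open>D\<close> is represented by a total function of which only the
  values on \<open>D\<close> matter.
\<close>

definition upper_ahlfors :: "'a::metric_space measure \<Rightarrow> 'a set \<Rightarrow> 'a set \<Rightarrow> real \<Rightarrow> bool" where
  "upper_ahlfors \<nu> X Y \<upsilon> \<longleftrightarrow>
    (\<exists>r0::ereal. \<exists>c::real. 0 < r0 \<and> 0 < c \<and>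
      (\<forall>x\<in>X. \<forall>r::real. 0 < r \<and> ereal r < r0 \<longrightarrow>
        emeasure \<nu> (ball x r \<inter> Y) \<le> ennreal (c * r powr \<upsilon>)))"

text \<open>Here \<open>r1 = 0\<close> is allowed, with \<open>ball x 0 = {}\<close> and \<open>0 powr \<upsilon> = 0\<close>.\<close>

definition strongly_upper_ahlfors ::
    "'a::metric_space measure \<Rightarrow> 'a set \<Rightarrow> 'a set \<Rightarrow> real \<Rightarrow> bool" where
  "strongly_upper_ahlfors \<nu> X Y \<upsilon> \<longleftrightarrow>
    (\<exists>r0::ereal. \<exists>c::real. 0 < r0 \<and> 0 < c \<and>
      (\<forall>x\<in>X. \<forall>r1 r2::real. 0 \<le> r1 \<and> r1 < r2 \<and> ereal r2 < r0 \<longrightarrow>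
        emeasure \<nu> ((ball x r2 - ball x r1) \<inter> Y) \<le> ennreal (c * (r2 powr \<upsilon> - r1 powr \<upsilon>))))"

text \<open>Values of a kernel on the diagonal are irrelevant: the constraints in the second supremum
  force \<open>y \<noteq> x'\<close> and \<open>y \<noteq> x''\<close>.\<close>

definition kernel_class ::
    "real \<Rightarrow> real \<Rightarrow> real \<Rightarrow> 'a::metric_space set \<Rightarrow> 'a set \<Rightarrow> ('a \<Rightarrow> 'a \<Rightarrow> complex) set" where
  "kernel_class s1 s2 s3 X Y =
    {K. continuous_on ((X \<times> Y) - {(x, y). x = y}) (\<lambda>(x, y). K x y) \<and>
      (SUP (x, y) \<in> {(x, y). x \<in> X \<and> y \<in> Y \<and> x \<noteq> y}.
          ennreal (dist x y powr s1 * norm (K x y)))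
      + (SUP (x', x'', y) \<in> {(x', x'', y). x' \<in> X \<and> x'' \<in> X \<and> x' \<noteq> x'' \<and>
                                 y \<in> Y - ball x' (2 * dist x' x'')}.
          ennreal (dist x' y powr s2 / dist x' x'' powr s3 * norm (K x' y - K x'' y)))
      < top}"

text \<open>The operator \<open>Q[Z, g, 1]\<close>. At \<open>y = x\<close> the integrand is 0 whatever the value of \<open>Z x x\<close>.\<close>

definition Q_op ::
    "'a measure \<Rightarrow> 'a set \<Rightarrow> ('a \<Rightarrow> 'a \<Rightarrow> complex) \<Rightarrow> ('a \<Rightarrow> complex) \<Rightarrow> 'a \<Rightarrow> complex" where
  "Q_op \<nu> Y Z g x = (LINT y:Y|\<nu>. Z x y * (g x - g y))"

definition holder_seminorm ::
    "(real \<Rightarrow> real) \<Rightarrow> 'a::metric_space set \<Rightarrow> ('a \<Rightarrow> complex) \<Rightarrow> ennreal" where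
  "holder_seminorm \<omega> D f =
    (SUP (x, y) \<in> {(x, y). x \<in> D \<and> y \<in> D \<and> x \<noteq> y}. ennreal (norm (f x - f y) / \<omega> (dist x y)))"

definition holder_space :: "(real \<Rightarrow> real) \<Rightarrow> 'a::metric_space set \<Rightarrow> ('a \<Rightarrow> complex) set" where
  "holder_space \<omega> D = {f. holder_seminorm \<omega> D f < top}"

definition holder_b_norm ::
    "(real \<Rightarrow> real) \<Rightarrow> 'a::metric_space set \<Rightarrow> ('a \<Rightarrow> complex) \<Rightarrow> ennreal" where
  "holder_b_norm \<omega> D f = (SUP x\<in>D. ennreal (norm (f x))) + holder_seminorm \<omega> D f"

definition holder_b_space :: "(real \<Rightarrow> real) \<Rightarrow> 'a::metric_space set \<Rightarrow> ('a \<Rightarrow> complex) set" where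
  "holder_b_space \<omega> D = {f \<in> holder_space \<omega> D. bounded (f ` D)}"

text \<open>Equality of two spaces \<open>C\<^sub>b\<^sup>0\<close> as sets, with equivalent norms.\<close>

definition holder_b_space_eq ::
    "(real \<Rightarrow> real) \<Rightarrow> (real \<Rightarrow> real) \<Rightarrow> 'a::metric_space set \<Rightarrow> bool" where
  "holder_b_space_eq \<omega>1 \<omega>2 D \<longleftrightarrow>
    holder_b_space \<omega>1 D = holder_b_space \<omega>2 D \<and>
    (\<exists>c::real. 0 < c \<and> (\<forall>f \<in> holder_b_space \<omega>1 D.
      holder_b_norm \<omega>1 D f \<le> ennreal c * holder_b_norm \<omega>2 D f \<and>
      holder_b_norm \<omega>2 D f \<le> ennreal c * holder_b_norm \<omega>1 D f))"

text \<open>\<open>T\<close> maps \<open>V\<close> into \<open>W\<close> and is continuous for the topologies induced by the semi-norms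
  \<open>p\<close> on \<open>V\<close> and \<open>q\<close> on \<open>W\<close>.\<close>

definition seminorm_continuous ::
    "('a \<Rightarrow> complex) set \<Rightarrow> (('a \<Rightarrow> complex) \<Rightarrow> ennreal) \<Rightarrow>
     ('a \<Rightarrow> complex) set \<Rightarrow> (('a \<Rightarrow> complex) \<Rightarrow> ennreal) \<Rightarrow>
     (('a \<Rightarrow> complex) \<Rightarrow> 'a \<Rightarrow> complex) \<Rightarrow> bool" where
  "seminorm_continuous V p W q T \<longleftrightarrow>
    (\<forall>g\<in>V. T g \<in> W) \<and>
    (\<forall>g\<in>V. \<forall>\<epsilon>::real. 0 < \<epsilon> \<longrightarrow> (\<exists>\<delta>::real. 0 < \<delta> \<and>
      (\<forall>h\<in>V. p (\<lambda>y. h y - g y) < ennreal \<delta> \<longrightarrow> q (\<lambda>x. T h x - T g x) < ennreal \<epsilon>)))"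

text \<open>Continuity of \<open>g \<mapsto> Q[Z, g, 1]\<close> from \<open>C\<^sup>0\<^sup>,\<^sup>\<beta>(X \<union> Y)\<close> to \<open>C\<^sub>b(X)\<close> with modulus \<open>\<omega>\<close>.\<close>

definition Q_continuous ::
    "'a::metric_space measure \<Rightarrow> 'a set \<Rightarrow> 'a set \<Rightarrow> ('a \<Rightarrow> 'a \<Rightarrow> complex) \<Rightarrow>
     real \<Rightarrow> (real \<Rightarrow> real) \<Rightarrow> bool" where
  "Q_continuous \<nu> X Y Z \<beta> \<omega> \<longleftrightarrow>
    seminorm_continuous
      (holder_space (\<lambda>r. r powr \<beta>) (X \<union> Y)) (holder_seminorm (\<lambda>r. r powr \<beta>) (X \<union> Y))
      (holder_b_space \<omega> X) (holder_b_norm \<omega> X)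
      (Q_op \<nu> Y Z)"

definition omega_log :: "real \<Rightarrow> real \<Rightarrow> real" where
  "omega_log \<theta> r =
    (let r\<^sub>\<theta> = exp (- 1 / \<theta>) in
     if r \<le> 0 then 0
     else if r \<le> r\<^sub>\<theta> then r powr \<theta> * \<bar>ln r\<bar>
     else r\<^sub>\<theta> powr \<theta> * \<bar>ln r\<^sub>\<theta>\<bar>)"

end

theory Submission
  imports Defs
begin

text \<open>
  All three parts come from one estimate, tested on \<open>g y = min (dist x y) r powr \<beta>\<close>, whose
  Hoelder seminorm is at most 1. As \<open>g\<close> is constant off \<open>ball x r\<close>, the value \<open>Q[Z, g, 1](x)\<close> equals
  \<open>- r powr \<beta>\<close> times the truncated integral, up to an integral over \<open>ball x r\<close>; for \<open>x'\<close> at distance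
  exactly \<open>r\<close> from \<open>x\<close>, \<open>Q[Z, g, 1](x')\<close> only involves an integral over \<open>ball x r\<close>. Both local
  integrals are \<open>O(r powr \<beta>)\<close> by Ahlfors regularity, and continuity of the operator bounds
  \<open>Q[Z, g, 1](x) - Q[Z, g, 1](x')\<close> by a multiple of \<open>\<omega> r\<close>.
\<close>

lemma abs_powr_diff_le:
  fixes a b \<beta> :: real
  assumes "0 \<le> a" "0 \<le> b" "0 < \<beta>" "\<beta> \<le> 1"
  shows "\<bar>a powr \<beta> - b powr \<beta>\<bar> \<le> \<bar>a - b\<bar> powr \<beta>"
proof -
  have *: "v powr \<beta> \<le> u powr \<beta> + (v - u) powr \<beta>" if "0 \<le> u" "u \<le> v" for u v :: real
  proof (cases "v = 0")
    case False
    with that have v: "0 < v" by simp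
    have t: "t \<le> t powr \<beta>" if "0 \<le> t" "t \<le> 1" for t :: real
    proof (cases "t = 0")
      case False
      then show ?thesis using powr_mono'[of \<beta> 1 t] that assms by simp
    qed simp
    have "1 \<le> (u / v) powr \<beta> + ((v - u) / v) powr \<beta>"
      using t[of "u / v"] t[of "(v - u) / v"] that v by (simp add: diff_divide_distrib)
    also have "\<dots> = (u powr \<beta> + (v - u) powr \<beta>) / v powr \<beta>"
      using that v by (simp add: powr_divide add_divide_distrib)
    finally show ?thesis using v by (simp add: pos_le_divide_eq)
  qed (use that in simp)
  show ?thesis
  proof (cases "a \<le> b")
    case True
    then have "a powr \<beta> \<le> b powr \<beta>" using assms by (intro powr_mono2) auto
    with *[of a b] True assms show ?thesis by simp
  next
    case False
    then have "b powr \<beta> \<le> a powr \<beta>" using assms by (intro powr_mono2) auto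
    with *[of b a] False assms show ?thesis by simp
  qed
qed

lemma strongly_upper_ahlfors_imp_upper_ahlfors:
  assumes "strongly_upper_ahlfors \<nu> X Y \<upsilon>"
  shows "upper_ahlfors \<nu> X Y \<upsilon>"
proof -
  from assms obtain r0 :: ereal and c :: real where r0: "0 < r0" "0 < c"
    and *: "\<And>x r1 r2. \<lbrakk>x \<in> X; 0 \<le> r1; r1 < r2; ereal r2 < r0\<rbrakk> \<Longrightarrow>
        emeasure \<nu> ((ball x r2 - ball x r1) \<inter> Y) \<le> ennreal (c * (r2 powr \<upsilon> - r1 powr \<upsilon>))"
    unfolding strongly_upper_ahlfors_def by blast
  have "emeasure \<nu> (ball x r \<inter> Y) \<le> ennreal (c * r powr \<upsilon>)"
    if "x \<in> X" "0 < r \<and> ereal r < r0" for x r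
    using *[of x 0 r] that by simp
  with r0 show ?thesis unfolding upper_ahlfors_def by blast
qed

lemma exists_dyadic_annulus:
  fixes d r :: real
  assumes "0 < d" "d < r"
  obtains k :: nat where "r * (1/2) ^ Suc k \<le> d" "d < r * (1/2) ^ k"
proof -
  obtain n :: nat where n: "(1/2) ^ n < d / r"
    using real_arch_pow_inv[of "d / r" "1/2"] assms by auto
  define m where "m = (LEAST n. r * (1/2) ^ n \<le> d)"
  have "r * (1/2) ^ n \<le> d" using n assms by (simp add: field_simps)
  then have m: "r * (1/2) ^ m \<le> d" unfolding m_def by (rule LeastI)
  have "m \<noteq> 0" using m assms by (intro notI) simp
  then obtain k where k: "m = Suc k" by (cases m) auto
  then have "\<not> r * (1/2) ^ k \<le> d" using not_less_Least[of k "\<lambda>n. r * (1/2) ^ n \<le> d"] by (simp add: m_def)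
  with m k that[of k] show thesis by simp
qed

lemma nn_integral_dist_powr_le:
  fixes X Y :: "'a::metric_space set"
  assumes space: "space \<nu> = Y" and sets: "sets (restrict_space borel Y) \<subseteq> sets \<nu>"
    and "0 < \<beta>" and ahlfors: "upper_ahlfors \<nu> X Y \<upsilon>"
  shows "\<exists>C>0. \<exists>r0>0. \<forall>x\<in>X. \<forall>r. 0 < r \<and> r < r0 \<longrightarrow>
    (\<integral>\<^sup>+y. ennreal (dist x y powr (\<beta> - \<upsilon>)) * indicator (ball x r) y \<partial>\<nu>) \<le> ennreal (C * r powr \<beta>)"
proof -
  from ahlfors obtain r0' :: ereal and c :: real where r0': "0 < r0'" and c: "0 < c"
    and meas: "\<And>x r. \<lbrakk>x \<in> X; 0 < r; ereal r < r0'\<rbrakk> \<Longrightarrow>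
        emeasure \<nu> (ball x r \<inter> Y) \<le> ennreal (c * r powr \<upsilon>)"
    unfolding upper_ahlfors_def by blast
  obtain r0 :: real where r0: "0 < r0" "ereal r0 < r0'"
    using ereal_dense2[OF r0'] by (auto simp: zero_ereal_def)
  define A where "A = 1 + (1/2) powr (\<beta> - \<upsilon>)"
  define q :: real where "q = (1/2) powr \<beta>"
  have A: "0 < A" unfolding A_def by (intro add_pos_nonneg) auto
  have q: "0 < q" "q < 1" using \<open>0 < \<beta>\<close> powr_less_mono2[of \<beta> "1/2" 1] by (auto simp: q_def)
  define C where "C = A * c / (1 - q)"
  have "0 < C" using A c q by (simp add: C_def)
  moreover have "(\<integral>\<^sup>+y. ennreal (dist x y powr (\<beta> - \<upsilon>)) * indicator (ball x r) y \<partial>\<nu>)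
      \<le> ennreal (C * r powr \<beta>)"
    if x: "x \<in> X" and r: "0 < r" "r < r0" for x r
  proof -
    define t where "t k = r * (1/2) ^ k" for k :: nat
    have t: "0 < t k" "t k \<le> r" for k
      using r by (auto simp: t_def mult_left_le power_le_one)
    define w where "w k = A * t k powr (\<beta> - \<upsilon>)" for k
    have w: "0 \<le> w k" for k using A by (simp add: w_def)
    have ballY: "ball x s \<inter> Y \<in> sets \<nu>" for s
      using sets by (rule subsetD) (auto simp: sets_restrict_space)
    have pt: "ennreal (dist x y powr (\<beta> - \<upsilon>)) * indicator (ball x r) y
        \<le> (\<Sum>k. ennreal (w k) * indicator (ball x (t k) \<inter> Y) y)" (is "?L \<le> ?R")
      if y: "y \<in> space \<nu>" for y
    proof (cases "0 < dist x y \<and> dist x y < r")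
      case True
      then obtain k where k: "t (Suc k) \<le> dist x y" "dist x y < t k"
        using exists_dyadic_annulus[of "dist x y" r] unfolding t_def by auto
      have half: "t (Suc k) = t k * (1/2)" by (simp add: t_def)
      have "dist x y powr (\<beta> - \<upsilon>) \<le> w k"
      proof (cases "0 \<le> \<beta> - \<upsilon>")
        case True
        then have "dist x y powr (\<beta> - \<upsilon>) \<le> 1 * t k powr (\<beta> - \<upsilon>)"
          using k by (simp add: powr_mono2)
        also have "\<dots> \<le> w k" unfolding w_def A_def by (intro mult_right_mono) auto
        finally show ?thesis .
      next
        case False
        then have "dist x y powr (\<beta> - \<upsilon>) \<le> (t k * (1/2)) powr (\<beta> - \<upsilon>)"
          using k t[of "Suc k"] unfolding half by (intro powr_mono2') auto
        also have "\<dots> = (1/2) powr (\<beta> - \<upsilon>) * t k powr (\<beta> - \<upsilon>)"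
          using t[of k] by (subst powr_mult) (auto simp: mult.commute)
        also have "\<dots> \<le> w k" unfolding w_def A_def by (intro mult_right_mono) auto
        finally show ?thesis .
      qed
      then have "?L \<le> ennreal (w k) * indicator (ball x (t k) \<inter> Y) y"
        using True k y space by (auto intro: ennreal_leI)
      moreover have "h k \<le> suminf h" for h :: "nat \<Rightarrow> ennreal"
        using sum_le_suminf[of h "{k}"] by simp
      ultimately show ?thesis by (rule order_trans)
    next
      case False
      then have "?L = 0" by (cases "x = y") (auto simp: indicator_def)
      then show ?thesis by (simp only: zero_le)
    qed
    have term_le: "ennreal (w k) * emeasure \<nu> (ball x (t k) \<inter> Y) \<le> ennreal (A * c * r powr \<beta> * q ^ k)" for k
    proof -
      have "ereal (t k) < r0'"
        using t[of k] r r0 by (intro le_less_trans[OF _ r0(2)]) simp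
      then have "ennreal (w k) * emeasure \<nu> (ball x (t k) \<inter> Y) \<le> ennreal (w k) * ennreal (c * t k powr \<upsilon>)"
        using meas[OF x t(1)[of k]] by (intro mult_left_mono) auto
      also have "\<dots> = ennreal (A * c * (t k powr (\<beta> - \<upsilon>) * t k powr \<upsilon>))"
        using w[of k] by (subst ennreal_mult'[symmetric]) (auto simp: w_def mult_ac)
      also have "t k powr (\<beta> - \<upsilon>) * t k powr \<upsilon> = t k powr \<beta>"
        by (simp add: powr_add[symmetric])
      also have "\<dots> = r powr \<beta> * q ^ k"
        using r by (simp add: t_def q_def powr_mult powr_power powr_realpow[symmetric] powr_powr mult.commute)
      finally show ?thesis by (simp add: mult.assoc)
    qed
    have "(\<integral>\<^sup>+y. ennreal (dist x y powr (\<beta> - \<upsilon>)) * indicator (ball x r) y \<partial>\<nu>)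
        \<le> (\<integral>\<^sup>+y. (\<Sum>k. ennreal (w k) * indicator (ball x (t k) \<inter> Y) y) \<partial>\<nu>)"
      by (rule nn_integral_mono) (rule pt)
    also have "\<dots> = (\<Sum>k. \<integral>\<^sup>+y. ennreal (w k) * indicator (ball x (t k) \<inter> Y) y \<partial>\<nu>)"
      using ballY by (intro nn_integral_suminf borel_measurable_times_ennreal borel_measurable_indicator) auto
    also have "\<dots> = (\<Sum>k. ennreal (w k) * emeasure \<nu> (ball x (t k) \<inter> Y))"
      using ballY by (simp add: nn_integral_cmult_indicator)
    also have "\<dots> \<le> (\<Sum>k. ennreal (A * c * r powr \<beta> * q ^ k))"
      by (intro suminf_le term_le) auto
    also have "\<dots> = ennreal (\<Sum>k. A * c * r powr \<beta> * q ^ k)"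
      using A c q by (intro suminf_ennreal2) (auto intro!: summable_mult summable_geometric)
    also have "(\<Sum>k. A * c * r powr \<beta> * q ^ k) = C * r powr \<beta>"
      using q by (simp add: suminf_mult suminf_geometric summable_geometric C_def)
    finally show ?thesis .
  qed
  ultimately show ?thesis using r0(1) by blast
qed

lemma borel_measurable_of_borel:
  assumes "space \<nu> = Y" "sets (restrict_space borel Y) \<subseteq> sets \<nu>" "f \<in> borel_measurable borel"
  shows "f \<in> borel_measurable \<nu>"
  using measurable_restrict_space1[OF assms(3), of Y] measurable_mono[of borel borel "restrict_space borel Y" \<nu>]
    assms by (auto simp: space_restrict_space)

lemma borel_measurable_continuous_on_subset:
  fixes f :: "'a::topological_space \<Rightarrow> 'b::real_normed_vector"
  assumes space: "space \<nu> = Y" and sets: "sets (restrict_space borel Y) \<subseteq> sets \<nu>"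
    and A: "A \<in> sets borel" and f: "continuous_on (Y \<inter> A) f"
  shows "(\<lambda>y. indicator (Y \<inter> A) y *\<^sub>R f y) \<in> borel_measurable \<nu>"
proof -
  let ?R = "restrict_space borel Y :: 'a measure"
  have "Y \<inter> A \<in> sets ?R" using A by (auto simp: sets_restrict_space)
  moreover have "f \<in> borel_measurable (restrict_space ?R (Y \<inter> A))"
    using borel_measurable_continuous_on_restrict[OF f]
    by (simp add: measurable_cong_sets[OF sets_restrict_restrict_space refl])
  ultimately have "(\<lambda>y. indicator (Y \<inter> A) y *\<^sub>R f y) \<in> borel_measurable ?R"
    by (subst (asm) borel_measurable_restrict_space_iff) auto
  then show ?thesis
    using measurable_mono[of borel borel ?R \<nu>] sets space by (auto simp: space_restrict_space)
qed

lemma norm_integral_le_of_nn_integral_le: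
  fixes f :: "'a \<Rightarrow> 'b::{banach, second_countable_topology}"
  assumes f: "f \<in> borel_measurable M" and le: "(\<integral>\<^sup>+y. ennreal (norm (f y)) \<partial>M) \<le> ennreal B" and "0 \<le> B"
  shows "integrable M f" "norm (integral\<^sup>L M f) \<le> B"
proof -
  show i: "integrable M f"
    using f le by (auto simp: integrable_iff_bounded intro: le_less_trans)
  have "ennreal (norm (integral\<^sup>L M f)) \<le> ennreal B"
    using integral_norm_bound_ennreal[OF i] le by (rule order_trans)
  then show "norm (integral\<^sup>L M f) \<le> B" using \<open>0 \<le> B\<close> by simp
qed

lemma kernel_class_bound:
  assumes "K \<in> kernel_class s1 s2 s3 X Y"
  shows "\<exists>B>0. \<forall>x\<in>X. \<forall>y\<in>Y. x \<noteq> y \<longrightarrow> norm (K x y) \<le> B * dist x y powr (- s1)"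
proof -
  define S where "S = (SUP (x, y) \<in> {(x, y). x \<in> X \<and> y \<in> Y \<and> x \<noteq> y}.
          ennreal (dist x y powr s1 * norm (K x y)))"
  have "S < top"
    using assms by (simp add: kernel_class_def S_def ennreal_add_less_top)
  then obtain B where B: "S = ennreal B" "0 \<le> B" by (cases S) auto
  have "norm (K x y) \<le> (B + 1) * dist x y powr (- s1)" if "x \<in> X" "y \<in> Y" "x \<noteq> y" for x y
  proof -
    have "ennreal (dist x y powr s1 * norm (K x y)) \<le> S"
      unfolding S_def by (rule SUP_upper2[of "(x, y)"]) (use that in auto)
    then have "dist x y powr s1 * norm (K x y) \<le> B" using B by simp
    then have "dist x y powr s1 * norm (K x y) \<le> B + 1" by simp
    then show ?thesis using that by (simp add: powr_minus field_simps)
  qed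
  then show ?thesis using B(2) by (intro exI[of _ "B + 1"]) auto
qed

lemma kernel_class_continuous:
  assumes "K \<in> kernel_class s1 s2 s3 X Y" "x \<in> X"
  shows "continuous_on (Y - {x}) (K x)"
proof -
  have "continuous_on ((X \<times> Y) - {(x, y). x = y}) (\<lambda>(x, y). K x y)"
    using assms by (simp add: kernel_class_def)
  then have "continuous_on (Y - {x}) (\<lambda>y. (\<lambda>(x, y). K x y) (x, y))"
    by (rule continuous_on_compose2) (use assms in \<open>auto intro!: continuous_intros\<close>)
  then show ?thesis by simp
qed

lemma holder_seminorm_le_iff:
  assumes "0 \<le> C" "\<And>r. 0 < r \<Longrightarrow> 0 < \<omega> r"
  shows "holder_seminorm \<omega> D f \<le> ennreal C \<longleftrightarrow>
    (\<forall>x\<in>D. \<forall>y\<in>D. x \<noteq> y \<longrightarrow> norm (f x - f y) \<le> C * \<omega> (dist x y))"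
proof -
  have "norm (f x - f y) / \<omega> (dist x y) \<le> C \<longleftrightarrow> norm (f x - f y) \<le> C * \<omega> (dist x y)" if "x \<noteq> y" for x y
    using assms(2)[of "dist x y"] that by (simp add: pos_divide_le_eq)
  then show ?thesis
    using assms(1) by (auto simp: holder_seminorm_def SUP_le_iff)
qed

lemma Q_continuous_imp_bounded:
  assumes Q: "Q_continuous \<nu> X Y Z \<beta> \<omega>" and \<omega>: "\<And>r. 0 < r \<Longrightarrow> 0 < \<omega> r"
  shows "\<exists>C>0. \<forall>g. holder_seminorm (\<lambda>r. r powr \<beta>) (X \<union> Y) g \<le> 1 \<longrightarrow>
    (\<forall>x\<in>X. \<forall>y\<in>X. x \<noteq> y \<longrightarrow> norm (Q_op \<nu> Y Z g x - Q_op \<nu> Y Z g y) \<le> C * \<omega> (dist x y))"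
proof -
  let ?p = "holder_seminorm (\<lambda>r. r powr \<beta>) (X \<union> Y)"
  have p0: "?p (\<lambda>_. 0) \<le> ennreal 0"
    by (subst holder_seminorm_le_iff) auto
  then have "(\<lambda>_. 0) \<in> holder_space (\<lambda>r. r powr \<beta>) (X \<union> Y)"
    by (simp add: holder_space_def)
  then obtain \<delta> :: real where \<delta>: "0 < \<delta>"
    and cont: "\<And>h. \<lbrakk>h \<in> holder_space (\<lambda>r. r powr \<beta>) (X \<union> Y); ?p (\<lambda>y. h y - 0) < ennreal \<delta>\<rbrakk> \<Longrightarrow>
       holder_b_norm \<omega> X (\<lambda>x. Q_op \<nu> Y Z h x - Q_op \<nu> Y Z (\<lambda>_. 0) x) < ennreal 1"
    using Q unfolding Q_continuous_def seminorm_continuous_def by (meson zero_less_one)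
  have "norm (Q_op \<nu> Y Z g x - Q_op \<nu> Y Z g y) \<le> 2 / \<delta> * \<omega> (dist x y)"
    if g: "?p g \<le> 1" and xy: "x \<in> X" "y \<in> X" "x \<noteq> y" for g x y
  proof -
    define h where "h = (\<lambda>y. of_real (\<delta> / 2) * g y)"
    have "norm (g u - g v) \<le> 1 * dist u v powr \<beta>" if "u \<in> X \<union> Y" "v \<in> X \<union> Y" "u \<noteq> v" for u v
      using g holder_seminorm_le_iff[of 1 "\<lambda>r. r powr \<beta>" "X \<union> Y" g] that by auto
    then have "norm (h u - h v) \<le> \<delta> / 2 * dist u v powr \<beta>" if "u \<in> X \<union> Y" "v \<in> X \<union> Y" "u \<noteq> v" for u v
      using that \<delta> unfolding h_def right_diff_distrib[symmetric] norm_mult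
      by (intro mult_mono) auto
    then have p: "?p h \<le> ennreal (\<delta> / 2)"
      using \<delta> by (subst holder_seminorm_le_iff) auto
    then have "?p h < ennreal \<delta>" using \<delta> by (elim le_less_trans) (simp add: ennreal_lessI)
    moreover have "h \<in> holder_space (\<lambda>r. r powr \<beta>) (X \<union> Y)"
      using p by (auto simp: holder_space_def intro: le_less_trans)
    moreover have Q_h: "Q_op \<nu> Y Z h x - Q_op \<nu> Y Z (\<lambda>_. 0) x = of_real (\<delta> / 2) * Q_op \<nu> Y Z g x" for x
    proof -
      have "(\<lambda>y. Z x y * (h x - h y)) = (\<lambda>y. of_real (\<delta> / 2) * (Z x y * (g x - g y)))"
        by (auto simp: h_def algebra_simps)
      then have "Q_op \<nu> Y Z h x = of_real (\<delta> / 2) * Q_op \<nu> Y Z g x"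
        unfolding Q_op_def by (simp only: set_integral_mult_right)
      then show ?thesis by (simp add: Q_op_def)
    qed
    ultimately have "holder_b_norm \<omega> X (\<lambda>x. of_real (\<delta> / 2) * Q_op \<nu> Y Z g x) < ennreal 1"
      using cont[of h] by (simp only: Q_h diff_zero)
    then have "holder_seminorm \<omega> X (\<lambda>x. of_real (\<delta> / 2) * Q_op \<nu> Y Z g x) \<le> ennreal 1"
      unfolding holder_b_norm_def by (meson add_increasing le_less_trans less_imp_le order_refl zero_le)
    then have "norm (of_real (\<delta> / 2) * Q_op \<nu> Y Z g x - of_real (\<delta> / 2) * Q_op \<nu> Y Z g y)
        \<le> 1 * \<omega> (dist x y)"
      using xy \<omega> by (subst (asm) holder_seminorm_le_iff) auto
    then have "\<delta> / 2 * norm (Q_op \<nu> Y Z g x - Q_op \<nu> Y Z g y) \<le> \<omega> (dist x y)"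
      using \<delta> unfolding right_diff_distrib[symmetric] norm_mult by simp
    then show ?thesis using \<delta> by (simp add: field_simps)
  qed
  with \<delta> show ?thesis by (intro exI[of _ "2 / \<delta>"]) auto
qed

lemma holder_b_space_eqI:
  fixes C :: real and D :: "'a::metric_space set"
  assumes "\<And>r. 0 < r \<Longrightarrow> 0 < \<omega>1 r" "\<And>r. 0 < r \<Longrightarrow> 0 < \<omega>2 r" "1 \<le> C"
    and "\<And>r. 0 < r \<Longrightarrow> \<omega>1 r \<le> C * \<omega>2 r" "\<And>r. 0 < r \<Longrightarrow> \<omega>2 r \<le> C * \<omega>1 r"
  shows "holder_b_space_eq \<omega>1 \<omega>2 D"
proof -
  have semi: "holder_seminorm \<sigma> D f \<le> ennreal C * holder_seminorm \<tau> D f"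
    if pos: "\<And>r. 0 < r \<Longrightarrow> 0 < \<sigma> r" "\<And>r. 0 < r \<Longrightarrow> 0 < \<tau> r"
      and le: "\<And>r. 0 < r \<Longrightarrow> \<tau> r \<le> C * \<sigma> r" for \<sigma> \<tau> and f :: "'a \<Rightarrow> complex"
    unfolding holder_seminorm_def
  proof (rule SUP_least, clarify)
    fix x y assume xy: "x \<in> D" "y \<in> D" "x \<noteq> y"
    let ?d = "dist x y"
    have "norm (f x - f y) / \<sigma> ?d \<le> C * (norm (f x - f y) / \<tau> ?d)"
      using pos[of ?d] le[of ?d] xy mult_left_mono[OF le[of ?d], of "norm (f x - f y)"]
      by (simp add: field_simps)
    then have "ennreal (norm (f x - f y) / \<sigma> ?d) \<le> ennreal C * ennreal (norm (f x - f y) / \<tau> ?d)"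
      using \<open>1 \<le> C\<close> by (subst ennreal_mult'[symmetric]) (auto intro: ennreal_leI)
    also have "\<dots> \<le> ennreal C * (SUP (x, y) \<in> {(x, y). x \<in> D \<and> y \<in> D \<and> x \<noteq> y}.
        ennreal (norm (f x - f y) / \<tau> (dist x y)))"
      by (intro mult_left_mono SUP_upper2[of "(x, y)"]) (use xy in auto)
    finally show "ennreal (norm (f x - f y) / \<sigma> ?d) \<le> \<dots>" .
  qed
  have norm: "holder_b_norm \<sigma> D f \<le> ennreal C * holder_b_norm \<tau> D f"
    if "\<And>r. 0 < r \<Longrightarrow> 0 < \<sigma> r" "\<And>r. 0 < r \<Longrightarrow> 0 < \<tau> r" "\<And>r. 0 < r \<Longrightarrow> \<tau> r \<le> C * \<sigma> r"
    for \<sigma> \<tau> and f :: "'a \<Rightarrow> complex"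
  proof -
    have "1 * (SUP x\<in>D. ennreal (norm (f x))) \<le> ennreal C * (SUP x\<in>D. ennreal (norm (f x)))"
      using \<open>1 \<le> C\<close> by (intro mult_right_mono) auto
    with semi[where \<sigma> = \<sigma> and \<tau> = \<tau> and f = f, OF that] show ?thesis
      by (simp add: holder_b_norm_def distrib_left add_mono)
  qed
  have "holder_space \<sigma> D \<subseteq> holder_space \<tau> D"
    if "\<And>r. 0 < r \<Longrightarrow> 0 < \<tau> r" "\<And>r. 0 < r \<Longrightarrow> 0 < \<sigma> r" "\<And>r. 0 < r \<Longrightarrow> \<sigma> r \<le> C * \<tau> r"
    for \<sigma> \<tau>
  proof
    fix f assume "f \<in> holder_space \<sigma> D"
    then have "ennreal C * holder_seminorm \<sigma> D f < top"
      by (simp add: holder_space_def ennreal_mult_less_top)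
    with semi[where \<sigma> = \<tau> and \<tau> = \<sigma> and f = f, OF that] show "f \<in> holder_space \<tau> D"
      by (auto simp: holder_space_def intro: le_less_trans)
  qed
  then have "holder_space \<omega>1 D = holder_space \<omega>2 D"
    using assms by (intro equalityI) auto
  then show ?thesis
    using assms norm unfolding holder_b_space_eq_def holder_b_space_def
    by (intro conjI exI[of _ C]) auto
qed

lemma kernel_far_part:
  fixes Z :: "'a::metric_space \<Rightarrow> 'a \<Rightarrow> complex"
  assumes space: "space \<nu> = Y" and sets: "sets (restrict_space borel Y) \<subseteq> sets \<nu>"
    and fin: "emeasure \<nu> Y < \<infinity>" and "0 < \<upsilon>" "0 < B" "0 < r"
    and bound: "\<And>y. \<lbrakk>y \<in> Y; x \<noteq> y\<rbrakk> \<Longrightarrow> norm (Z x y) \<le> B * dist x y powr (- \<upsilon>)"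
    and cont: "continuous_on (Y - {x}) (Z x)"
  shows "set_integrable \<nu> (Y - ball x r) (Z x)"
    and "norm (LINT y:(Y - ball x r)|\<nu>. Z x y) \<le> B * r powr (- \<upsilon>) * measure \<nu> Y"
proof -
  have "continuous_on (Y \<inter> - ball x r) (Z x)"
    using \<open>0 < r\<close> by (intro continuous_on_subset[OF cont]) auto
  then have m: "(\<lambda>y. indicator (Y - ball x r) y *\<^sub>R Z x y) \<in> borel_measurable \<nu>"
    using borel_measurable_continuous_on_subset[OF space sets, of "- ball x r" "Z x"]
    by (simp add: Diff_eq borel_comp)
  have "norm (indicator (Y - ball x r) y *\<^sub>R Z x y) \<le> B * r powr (- \<upsilon>)" for y
  proof (cases "y \<in> Y - ball x r")
    case True
    then have "x \<noteq> y" using \<open>0 < r\<close> by auto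
    with True have "norm (Z x y) \<le> B * dist x y powr (- \<upsilon>)" using bound by simp
    also have "\<dots> \<le> B * r powr (- \<upsilon>)"
      using True assms by (intro mult_left_mono powr_mono2') auto
    finally show ?thesis using True by simp
  qed (use assms in auto)
  then have "(\<integral>\<^sup>+y. ennreal (norm (indicator (Y - ball x r) y *\<^sub>R Z x y)) \<partial>\<nu>)
      \<le> (\<integral>\<^sup>+y. ennreal (B * r powr (- \<upsilon>)) \<partial>\<nu>)"
    by (intro nn_integral_mono ennreal_leI)
  also have "\<dots> = ennreal (B * r powr (- \<upsilon>) * measure \<nu> Y)"
    using fin space \<open>0 < B\<close> by (simp add: emeasure_eq_ennreal_measure ennreal_mult)
  finally have le: "(\<integral>\<^sup>+y. ennreal (norm (indicator (Y - ball x r) y *\<^sub>R Z x y)) \<partial>\<nu>)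
      \<le> ennreal (B * r powr (- \<upsilon>) * measure \<nu> Y)" .
  from norm_integral_le_of_nn_integral_le[OF m le] \<open>0 < B\<close>
  show "set_integrable \<nu> (Y - ball x r) (Z x)"
    and "norm (LINT y:(Y - ball x r)|\<nu>. Z x y) \<le> B * r powr (- \<upsilon>) * measure \<nu> Y"
    by (auto simp: set_integrable_def set_lebesgue_integral_def)
qed

lemma truncated_integral_bound:
  fixes X Y :: "'a::metric_space set" and Z :: "'a \<Rightarrow> 'a \<Rightarrow> complex"
  assumes spheres: "\<exists>a>0. \<forall>\<rho>. 0 < \<rho> \<and> \<rho> < a \<longrightarrow> (\<forall>x'\<in>X. \<exists>x''\<in>X. dist x' x'' = \<rho>)"
    and "0 < \<upsilon>" and \<beta>: "0 < \<beta>" "\<beta> \<le> 1"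
    and space: "space \<nu> = Y" and sets: "sets (restrict_space borel Y) \<subseteq> sets \<nu>"
    and fin: "emeasure \<nu> Y < \<infinity>"
    and Z: "Z \<in> kernel_class \<upsilon> s2 s3 X Y"
    and ahlfors: "upper_ahlfors \<nu> X Y \<upsilon>"
    and Q: "Q_continuous \<nu> X Y Z \<beta> \<omega>" and \<omega>: "\<And>r. 0 < r \<Longrightarrow> 0 < \<omega> r"
  shows "\<exists>C>0. \<forall>x\<in>X. \<forall>r>0.
    norm (LINT y:(Y - ball x r)|\<nu>. Z x y) * (r powr \<beta> / max (r powr \<beta>) (\<omega> r)) \<le> C"
proof -
  obtain a where a: "0 < a" "\<And>\<rho> x'. \<lbrakk>0 < \<rho>; \<rho> < a; x' \<in> X\<rbrakk> \<Longrightarrow> \<exists>x''\<in>X. dist x' x'' = \<rho>"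
    using spheres by blast
  obtain B where B: "0 < B"
    "\<And>x y. \<lbrakk>x \<in> X; y \<in> Y; x \<noteq> y\<rbrakk> \<Longrightarrow> norm (Z x y) \<le> B * dist x y powr (- \<upsilon>)"
    using kernel_class_bound[OF Z] by blast
  obtain C1 r0 where C1: "0 < C1" "0 < r0"
    "\<And>x r. \<lbrakk>x \<in> X; 0 < r; r < r0\<rbrakk> \<Longrightarrow>
      (\<integral>\<^sup>+y. ennreal (dist x y powr (\<beta> - \<upsilon>)) * indicator (ball x r) y \<partial>\<nu>) \<le> ennreal (C1 * r powr \<beta>)"
    using nn_integral_dist_powr_le[OF space sets \<beta>(1) ahlfors] by blast
  obtain C2 where C2: "0 < C2"
    "\<And>g x y. \<lbrakk>holder_seminorm (\<lambda>r. r powr \<beta>) (X \<union> Y) g \<le> 1; x \<in> X; y \<in> X; x \<noteq> y\<rbrakk> \<Longrightarrow>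
      norm (Q_op \<nu> Y Z g x - Q_op \<nu> Y Z g y) \<le> C2 * \<omega> (dist x y)"
    using Q_continuous_imp_bounded[OF Q \<omega>] by blast
  note cont = kernel_class_continuous[OF Z]
  have far: "set_integrable \<nu> (Y - ball x r) (Z x)"
    "norm (LINT y:(Y - ball x r)|\<nu>. Z x y) \<le> B * r powr (- \<upsilon>) * measure \<nu> Y"
    if "x \<in> X" "0 < r" for x r
    using kernel_far_part[where x = x and Z = Z,
        OF space sets fin \<open>0 < \<upsilon>\<close> B(1) that(2) B(2)[OF that(1)] cont[OF that(1)]] by blast+
  have near: "integrable \<nu> F \<and> norm (integral\<^sup>L \<nu> F) \<le> B * (C1 * s powr \<beta>)"
    if F: "F \<in> borel_measurable \<nu>" and u: "u \<in> X" "0 < s" "s < r0"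
      and le: "\<And>y. y \<in> Y \<Longrightarrow> norm (F y) \<le> B * (dist u y powr (\<beta> - \<upsilon>) * indicator (ball u s) y)"
    for F :: "'a \<Rightarrow> complex" and u s
  proof -
    let ?h = "\<lambda>y. ennreal (dist u y powr (\<beta> - \<upsilon>)) * indicator (ball u s) y"
    have "(\<integral>\<^sup>+y. ennreal (norm (F y)) \<partial>\<nu>) \<le> (\<integral>\<^sup>+y. ennreal B * ?h y \<partial>\<nu>)"
    proof (rule nn_integral_mono)
      fix y assume "y \<in> space \<nu>"
      then show "ennreal (norm (F y)) \<le> ennreal B * ?h y"
        using le[of y] B(1) space by (auto simp: ennreal_mult'[symmetric] indicator_def intro: ennreal_leI split: if_splits)
    qed
    also have "\<dots> = ennreal B * (\<integral>\<^sup>+y. ?h y \<partial>\<nu>)"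
    proof (intro nn_integral_cmult borel_measurable_of_borel[OF space sets])
      have [measurable]: "(\<lambda>y. dist u y) \<in> borel_measurable borel" "ball u s \<in> sets borel"
        by (auto intro!: borel_measurable_continuous_onI continuous_on_dist continuous_on_const continuous_on_id)
      show "?h \<in> borel_measurable borel" by measurable
    qed
    also have "\<dots> \<le> ennreal B * ennreal (C1 * s powr \<beta>)"
      using C1(3)[OF u] by (intro mult_left_mono) auto
    also have "\<dots> = ennreal (B * (C1 * s powr \<beta>))"
      using B(1) by (simp add: ennreal_mult')
    finally show ?thesis
      using norm_integral_le_of_nn_integral_le[OF F] B(1) C1(1) by simp
  qed
  define r1 where "r1 = min a (r0 / 2)"
  have r1: "0 < r1" using a(1) C1(2) by (simp add: r1_def)
  define C where "C = max (B * C1 * (1 + 2 powr \<beta>) + C2) (B * r1 powr (- \<upsilon>) * measure \<nu> Y)"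
  have "0 < B * C1 * (1 + 2 powr \<beta>) + C2"
    using B(1) C1(1) C2(1) by (intro add_pos_pos mult_pos_pos) auto
  then have "0 < C" by (simp add: C_def)
  moreover have "norm (LINT y:(Y - ball x r)|\<nu>. Z x y) * (r powr \<beta> / max (r powr \<beta>) (\<omega> r)) \<le> C"
    if x: "x \<in> X" and r: "0 < r" for x r
  proof (cases "r < r1")
    case True
    let ?I = "LINT y:(Y - ball x r)|\<nu>. Z x y"
    have ra: "r < a" "r < r0" "2 * r < r0" using True C1(2) by (auto simp: r1_def)
    obtain x' where x': "x' \<in> X" "dist x x' = r" using a(2)[OF r ra(1) x] by blast
    define f where "f y = min (dist x y) r powr \<beta>" for y
    define g where "g y = complex_of_real (f y)" for y
    have g_diff: "norm (g u - g v) \<le> dist u v powr \<beta>" for u v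
    proof -
      have "norm (g u - g v) = \<bar>f u - f v\<bar>"
        unfolding g_def of_real_diff[symmetric] norm_of_real ..
      also have "\<dots> \<le> \<bar>min (dist x u) r - min (dist x v) r\<bar> powr \<beta>"
        unfolding f_def using \<beta> r by (intro abs_powr_diff_le) auto
      also have "\<bar>min (dist x u) r - min (dist x v) r\<bar> \<le> dist u v"
        using dist_triangle[of x u v] dist_triangle[of x v u] dist_commute[of u v] by linarith
      then have "\<bar>min (dist x u) r - min (dist x v) r\<bar> powr \<beta> \<le> dist u v powr \<beta>"
        using \<beta> by (intro powr_mono2) auto
      finally show ?thesis .
    qed
    then have g1: "holder_seminorm (\<lambda>r. r powr \<beta>) (X \<union> Y) g \<le> 1"
      using holder_seminorm_le_iff[of 1 "\<lambda>r. r powr \<beta>" "X \<union> Y" g] by simp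
    have g_cont: "continuous_on S g" for S
      unfolding g_def f_def using r \<beta>
      by (intro continuous_on_of_real continuous_on_powr' continuous_intros) auto
    define T where "T u y = indicator Y y *\<^sub>R (Z u y * (g u - g y))" for u y
    have Q_T: "Q_op \<nu> Y Z g u = integral\<^sup>L \<nu> (T u)" for u
      unfolding Q_op_def set_lebesgue_integral_def T_def ..
    have T_meas: "T u \<in> borel_measurable \<nu>" if "u \<in> X" for u
    proof -
      have "T u = (\<lambda>y. indicator (Y \<inter> - {u}) y *\<^sub>R (Z u y * (g u - g y)))"
        by (auto simp: T_def indicator_def)
      moreover have "continuous_on (Y \<inter> - {u}) (\<lambda>y. Z u y * (g u - g y))"
        using cont[OF that] by (intro continuous_intros g_cont) (simp add: Diff_eq)
      ultimately show ?thesis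
        using borel_measurable_continuous_on_subset[OF space sets, of "- {u}"] by simp
    qed
    have T_le: "norm (T u y) \<le> B * dist u y powr (\<beta> - \<upsilon>)" if "u \<in> X" "y \<in> Y" for u y
    proof (cases "u = y")
      case False
      then have "norm (T u y) \<le> B * dist u y powr (- \<upsilon>) * dist u y powr \<beta>"
        using that B g_diff[of u y] by (auto simp: T_def norm_mult intro!: mult_mono)
      also have "\<dots> = B * dist u y powr (\<beta> - \<upsilon>)"
        by (simp add: mult.assoc powr_add[symmetric])
      finally show ?thesis .
    qed (simp add: T_def)
    have g_far: "g y = of_real (r powr \<beta>)" if "y \<notin> ball x r" for y
      using that by (simp add: g_def f_def min_def)
    have gx: "g x = 0" using r \<beta> by (simp add: g_def f_def)
    have gx': "g x' = of_real (r powr \<beta>)" using x' by (intro g_far) simp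
    define G where "G y = of_real (r powr \<beta>) * (indicator (Y - ball x r) y *\<^sub>R Z x y)" for y
    have G: "integrable \<nu> G" "integral\<^sup>L \<nu> G = of_real (r powr \<beta>) * ?I"
      unfolding G_def set_lebesgue_integral_def
      by (rule integrable_mult_right far(1)[OF x r, unfolded set_integrable_def] integral_mult_right_zero)+
    have "norm (T x y + G y) \<le> B * (dist x y powr (\<beta> - \<upsilon>) * indicator (ball x r) y)" if "y \<in> Y" for y
      using T_le[OF x that] g_far[of y] that by (auto simp: T_def G_def gx indicator_def)
    then have N1: "integrable \<nu> (\<lambda>y. T x y + G y)"
      "norm (integral\<^sup>L \<nu> (\<lambda>y. T x y + G y)) \<le> B * (C1 * r powr \<beta>)"
      using near[of "\<lambda>y. T x y + G y" x r] T_meas[OF x] G(1) x r ra by auto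
    have "integral\<^sup>L \<nu> (\<lambda>y. T x y + G y - G y) = integral\<^sup>L \<nu> (\<lambda>y. T x y + G y) - integral\<^sup>L \<nu> G"
      by (rule Bochner_Integration.integral_diff[OF N1(1) G(1)])
    then have Qx: "of_real (r powr \<beta>) * ?I = integral\<^sup>L \<nu> (\<lambda>y. T x y + G y) - Q_op \<nu> Y Z g x"
      by (simp add: Q_T G(2))
    have "norm (T x' y) \<le> B * (dist x' y powr (\<beta> - \<upsilon>) * indicator (ball x' (2 * r)) y)" if "y \<in> Y" for y
    proof (cases "y \<in> ball x r")
      case True
      then have "y \<in> ball x' (2 * r)"
        using dist_triangle[of x' y x] x' by (simp add: dist_commute)
      then show ?thesis using T_le[OF x'(1) that] by simp
    next
      case False
      then have "T x' y = 0" by (simp add: T_def gx' g_far)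
      then show ?thesis using B(1) by simp
    qed
    then have N2: "norm (Q_op \<nu> Y Z g x') \<le> B * (C1 * (2 * r) powr \<beta>)"
      using near[of "T x'" x' "2 * r"] T_meas x' r ra by (simp add: Q_T)
    have N3: "norm (Q_op \<nu> Y Z g x - Q_op \<nu> Y Z g x') \<le> C2 * \<omega> r"
      using C2(2)[OF g1 x x'(1)] x' r by auto
    let ?m = "max (r powr \<beta>) (\<omega> r)"
    have m: "0 < ?m" using r by (simp add: less_max_iff_disj)
    have "norm ?I * r powr \<beta> = norm (of_real (r powr \<beta>) * ?I)"
      by (simp add: norm_mult)
    also have "\<dots> = norm (integral\<^sup>L \<nu> (\<lambda>y. T x y + G y) - Q_op \<nu> Y Z g x'
        - (Q_op \<nu> Y Z g x - Q_op \<nu> Y Z g x'))"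
      unfolding Qx by simp
    also have "\<dots> \<le> B * (C1 * r powr \<beta>) + B * (C1 * (2 * r) powr \<beta>) + C2 * \<omega> r"
      using N1(2) N2 N3 norm_triangle_ineq4 by (smt (verit))
    also have "\<dots> = B * C1 * (1 + 2 powr \<beta>) * r powr \<beta> + C2 * \<omega> r"
      using r by (simp add: powr_mult algebra_simps)
    also have "\<dots> \<le> B * C1 * (1 + 2 powr \<beta>) * ?m + C2 * ?m"
      using B(1) C1(1) C2(1) by (intro add_mono mult_left_mono) auto
    also have "\<dots> \<le> C * ?m"
      using m unfolding C_def distrib_right[symmetric] by (intro mult_right_mono) auto
    finally show ?thesis using m by (simp add: pos_divide_le_eq)
  next
    case False
    have "norm (LINT y:(Y - ball x r)|\<nu>. Z x y) * (r powr \<beta> / max (r powr \<beta>) (\<omega> r))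
        \<le> norm (LINT y:(Y - ball x r)|\<nu>. Z x y)"
      using r by (intro mult_right_le_one_le) (auto simp: divide_le_eq_1 le_max_iff_disj less_max_iff_disj)
    also have "\<dots> \<le> B * r powr (- \<upsilon>) * measure \<nu> Y"
      by (rule far(2)[OF x r])
    also have "\<dots> \<le> B * r1 powr (- \<upsilon>) * measure \<nu> Y"
      using False r1 B(1) \<open>0 < \<upsilon>\<close> by (intro mult_right_mono mult_left_mono powr_mono2') auto
    also have "\<dots> \<le> C" by (simp add: C_def)
    finally show ?thesis .
  qed
  ultimately show ?thesis by blast
qed

lemma omega_log_le_powr:
  assumes "0 < \<beta>" "\<beta> < \<theta>"
  shows "\<exists>C\<ge>1. \<forall>r>0. omega_log \<theta> r \<le> C * r powr \<beta>"
proof -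
  define q where "q = exp (- 1 / \<theta>)"
  have q: "0 < q" "q < 1" using assms by (auto simp: q_def)
  define M where "M = q powr \<theta> * \<bar>ln q\<bar>"
  have M: "0 \<le> M" by (simp add: M_def)
  define C where "C = 1 + 1 / (\<theta> - \<beta>) + M / q powr \<beta>"
  have "omega_log \<theta> r \<le> C * r powr \<beta>" if r: "0 < r" for r
  proof (cases "r \<le> q")
    case True
    have "ln (1 / r) \<le> (1 / r) powr (\<theta> - \<beta>) / (\<theta> - \<beta>)"
      using r True q assms by (intro ln_powr_bound) auto
    then have "\<bar>ln r\<bar> \<le> r powr (\<beta> - \<theta>) / (\<theta> - \<beta>)"
      using r True q by (simp add: ln_div powr_divide powr_minus_divide[symmetric])
    then have "r powr \<theta> * \<bar>ln r\<bar> \<le> r powr \<theta> * (r powr (\<beta> - \<theta>) / (\<theta> - \<beta>))"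
      by (intro mult_left_mono) auto
    also have "\<dots> = 1 / (\<theta> - \<beta>) * r powr \<beta>"
      by (simp add: powr_add[symmetric])
    also have "\<dots> \<le> C * r powr \<beta>"
      using M by (intro mult_right_mono) (auto simp: C_def)
    finally show ?thesis using r True by (simp add: omega_log_def q_def)
  next
    case False
    have "M = M / q powr \<beta> * q powr \<beta>" using q by simp
    also have "\<dots> \<le> C * r powr \<beta>"
      using M False q assms by (intro mult_mono powr_mono2) (auto simp: C_def)
    finally show ?thesis using r False by (simp add: omega_log_def q_def M_def)
  qed
  moreover have "1 \<le> C" using M assms by (simp add: C_def)
  ultimately show ?thesis by blast
qed

lemma SUP_SUP_ennreal_less_top:
  fixes F :: "'a \<Rightarrow> 'b \<Rightarrow> real"
  assumes "\<And>x r. \<lbrakk>x \<in> X; r \<in> R\<rbrakk> \<Longrightarrow> F x r \<le> C"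
  shows "(SUP x\<in>X. SUP r\<in>R. ennreal (F x r)) < \<infinity>"
proof -
  have "(SUP x\<in>X. SUP r\<in>R. ennreal (F x r)) \<le> ennreal C"
    using assms by (intro SUP_least ennreal_leI)
  then show ?thesis by (rule le_less_trans) simp
qed

theorem proposition2p6:
  fixes X Y :: "'a::metric_space set"
    and \<nu> :: "'a measure"
    and Z :: "'a \<Rightarrow> 'a \<Rightarrow> complex"
    and \<upsilon> \<beta> s2 s3 :: real
  assumes "\<exists>a>0. \<forall>\<rho>. 0 < \<rho> \<and> \<rho> < a \<longrightarrow> (\<forall>x'\<in>X. \<exists>x''\<in>X. dist x' x'' = \<rho>)"
    and "0 < \<upsilon>" and "0 < \<beta>" and "\<beta> \<le> 1" and "\<beta> \<le> s2" and "0 < s3" and "s3 \<le> 1"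
    and "space \<nu> = Y" and "sets (restrict_space borel Y) \<subseteq> sets \<nu>"
    and "emeasure \<nu> Y < \<infinity>"
    and "Z \<in> kernel_class \<upsilon> s2 s3 X Y"
  shows
    "(\<forall>x\<in>X. \<forall>r>0. set_integrable \<nu> (Y - ball x r) (Z x)) \<and>
     (s2 - \<beta> > \<upsilon> \<and> s2 < \<upsilon> + \<beta> + s3 \<and> upper_ahlfors \<nu> X Y \<upsilon> \<and>
      Q_continuous \<nu> X Y Z \<beta> (\<lambda>r. r powr min \<beta> (\<upsilon> + s3 + \<beta> - s2)) \<longrightarrow>
        (SUP x\<in>X. SUP r\<in>{0<..<exp (- 1 / s3)}.
          ennreal (norm (LINT y:(Y - ball x r)|\<nu>. Z x y)
            * (r powr \<beta> / max (r powr \<beta>) (r powr (\<upsilon> + s3 + \<beta> - s2))))) < \<infinity> \<and>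
        (s2 \<le> \<upsilon> + s3 \<longrightarrow>
          min \<beta> (\<upsilon> + s3 + \<beta> - s2) = \<beta> \<and>
          (SUP x\<in>X. SUP r\<in>{0<..}. ennreal (norm (LINT y:(Y - ball x r)|\<nu>. Z x y))) < \<infinity>)) \<and>
     (s2 - \<beta> = \<upsilon> \<and> strongly_upper_ahlfors \<nu> X Y \<upsilon> \<and>
      Q_continuous \<nu> X Y Z \<beta> (\<lambda>r. max (r powr \<beta>) (omega_log s3 r)) \<longrightarrow>
        (SUP x\<in>X. SUP r\<in>{0<..<exp (- 1 / s3)}.
          ennreal (norm (LINT y:(Y - ball x r)|\<nu>. Z x y)
            * (r powr \<beta> / max (r powr \<beta>) (omega_log s3 r)))) < \<infinity> \<and>
        (s3 > \<beta> \<longrightarrow>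
          holder_b_space_eq (\<lambda>r. max (r powr \<beta>) (omega_log s3 r)) (\<lambda>r. r powr \<beta>) X \<and>
          (SUP x\<in>X. SUP r\<in>{0<..}. ennreal (norm (LINT y:(Y - ball x r)|\<nu>. Z x y))) < \<infinity>)) \<and>
     (s2 - \<beta> < \<upsilon> \<and> upper_ahlfors \<nu> X Y \<upsilon> \<and>
      Q_continuous \<nu> X Y Z \<beta> (\<lambda>r. r powr min \<beta> s3) \<longrightarrow>
        (SUP x\<in>X. SUP r\<in>{0<..<exp (- 1 / s3)}.
          ennreal (norm (LINT y:(Y - ball x r)|\<nu>. Z x y)
            * (r powr \<beta> / max (r powr \<beta>) (r powr s3)))) < \<infinity> \<and>
        (s3 \<ge> \<beta> \<longrightarrow>
          holder_b_space_eq (\<lambda>r. r powr min \<beta> s3) (\<lambda>r. r powr \<beta>) X \<and>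
          (SUP x\<in>X. SUP r\<in>{0<..}. ennreal (norm (LINT y:(Y - ball x r)|\<nu>. Z x y))) < \<infinity>))"
proof (intro conjI impI; (elim conjE)?)
  obtain B where B: "0 < B"
    "\<And>x y. \<lbrakk>x \<in> X; y \<in> Y; x \<noteq> y\<rbrakk> \<Longrightarrow> norm (Z x y) \<le> B * dist x y powr (- \<upsilon>)"
    using kernel_class_bound[OF assms(11)] by blast
  show "\<forall>x\<in>X. \<forall>r>0. set_integrable \<nu> (Y - ball x r) (Z x)"
    using kernel_far_part(1)[where Z = Z, OF assms(8,9,10,2) B(1) _ B(2) kernel_class_continuous[OF assms(11)]]
    by blast
next
  let ?I = "\<lambda>x r. norm (LINT y:(Y - ball x r)|\<nu>. Z x y)"
  note bound = truncated_integral_bound[OF assms(1-4,8-11)]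
  have main: "(SUP x\<in>X. SUP r\<in>{0<..<exp (- 1 / s3)}.
      ennreal (?I x r * (r powr \<beta> / max (r powr \<beta>) (\<omega>' r)))) < \<infinity>"
    if Q: "upper_ahlfors \<nu> X Y \<upsilon>" "Q_continuous \<nu> X Y Z \<beta> \<omega>" "\<And>r. 0 < r \<Longrightarrow> 0 < \<omega> r"
      and eq: "\<And>r. \<lbrakk>0 < r; r < 1\<rbrakk> \<Longrightarrow> max (r powr \<beta>) (\<omega>' r) = max (r powr \<beta>) (\<omega> r)" for \<omega> \<omega>'
  proof -
    obtain C where C: "\<And>x r. \<lbrakk>x \<in> X; 0 < r\<rbrakk> \<Longrightarrow> ?I x r * (r powr \<beta> / max (r powr \<beta>) (\<omega> r)) \<le> C"
      using bound[OF Q] by blast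
    have "r < 1" if "r < exp (- 1 / s3)" for r
      using that \<open>0 < s3\<close> by (elim less_trans) simp
    then show ?thesis
      by (intro SUP_SUP_ennreal_less_top[where C = C]) (use C in \<open>auto simp: eq\<close>)
  qed
  have star: "(SUP x\<in>X. SUP r\<in>{0<..}. ennreal (?I x r)) < \<infinity>"
    if Q: "upper_ahlfors \<nu> X Y \<upsilon>" "Q_continuous \<nu> X Y Z \<beta> \<omega>" "\<And>r. 0 < r \<Longrightarrow> 0 < \<omega> r"
      and le: "\<And>r. 0 < r \<Longrightarrow> \<omega> r \<le> c * r powr \<beta>" "1 \<le> c" for \<omega> c
  proof -
    obtain C where C: "\<And>x r. \<lbrakk>x \<in> X; 0 < r\<rbrakk> \<Longrightarrow> ?I x r * (r powr \<beta> / max (r powr \<beta>) (\<omega> r)) \<le> C"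
      using bound[OF Q] by blast
    have "?I x r \<le> c * C" if "x \<in> X" "0 < r" for x r
    proof -
      have "r powr \<beta> \<le> c * r powr \<beta>" using le(2) mult_right_mono[of 1 c "r powr \<beta>"] by simp
      then have "max (r powr \<beta>) (\<omega> r) \<le> c * r powr \<beta>" using le(1)[OF that(2)] by simp
      then have "1 / c \<le> r powr \<beta> / max (r powr \<beta>) (\<omega> r)"
        using le(2) that(2) by (simp add: divide_simps less_max_iff_disj mult.commute)
      then have "?I x r * (1 / c) \<le> ?I x r * (r powr \<beta> / max (r powr \<beta>) (\<omega> r))"
        by (intro mult_left_mono) auto
      also have "\<dots> \<le> C" using C[OF that] .
      finally show ?thesis using le(2) by (simp add: pos_divide_le_eq mult.commute)
    qed
    then show ?thesis by (intro SUP_SUP_ennreal_less_top[where C = "c * C"]) auto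
  qed
  have powr_min: "r powr min p q = max (r powr p) (r powr q)" if "0 < r" "r < 1" for r p q :: real
    using that powr_mono'[of p q r] powr_mono'[of q p r] by (auto simp: min_def max_def)
  {
    assume i: "upper_ahlfors \<nu> X Y \<upsilon>"
      "Q_continuous \<nu> X Y Z \<beta> (\<lambda>r. r powr min \<beta> (\<upsilon> + s3 + \<beta> - s2))"
    show "(SUP x\<in>X. SUP r\<in>{0<..<exp (- 1 / s3)}.
          ennreal (?I x r * (r powr \<beta> / max (r powr \<beta>) (r powr (\<upsilon> + s3 + \<beta> - s2))))) < \<infinity>"
      by (rule main[OF i]) (auto simp: powr_min)
    assume le: "s2 \<le> \<upsilon> + s3"
    then show eq: "min \<beta> (\<upsilon> + s3 + \<beta> - s2) = \<beta>" by simp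
    show "(SUP x\<in>X. SUP r\<in>{0<..}. ennreal (?I x r)) < \<infinity>"
      by (rule star[OF i, of 1]) (auto simp: eq)
  }
  {
    let ?\<omega> = "\<lambda>r. max (r powr \<beta>) (omega_log s3 r)"
    assume "strongly_upper_ahlfors \<nu> X Y \<upsilon>" and Q: "Q_continuous \<nu> X Y Z \<beta> ?\<omega>"
    then have ii: "upper_ahlfors \<nu> X Y \<upsilon>"
      by (simp add: strongly_upper_ahlfors_imp_upper_ahlfors)
    show "(SUP x\<in>X. SUP r\<in>{0<..<exp (- 1 / s3)}.
          ennreal (?I x r * (r powr \<beta> / ?\<omega> r))) < \<infinity>"
      by (rule main[OF ii Q]) (auto simp: less_max_iff_disj)
    assume "\<beta> < s3"
    then obtain c where c: "1 \<le> c" "\<And>r. 0 < r \<Longrightarrow> omega_log s3 r \<le> c * r powr \<beta>"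
      using omega_log_le_powr[OF assms(3)] by blast
    have "r powr \<beta> \<le> c * s" if "r powr \<beta> \<le> s" for r s
    proof -
      have "0 \<le> s" using that by (meson order_trans powr_ge_zero)
      then show ?thesis using that c(1) mult_right_mono[of 1 c s] by simp
    qed
    with c(2) have c': "r powr \<beta> \<le> c * ?\<omega> r" "?\<omega> r \<le> c * r powr \<beta>" if "0 < r" for r
      using that by auto
    show "holder_b_space_eq ?\<omega> (\<lambda>r. r powr \<beta>) X"
      using c' by (intro holder_b_space_eqI[OF _ _ c(1)]) (auto simp: less_max_iff_disj)
    show "(SUP x\<in>X. SUP r\<in>{0<..}. ennreal (?I x r)) < \<infinity>"
      using c'(2) by (intro star[OF ii Q _ _ c(1)]) (auto simp: less_max_iff_disj)
  }
  {
    assume iii: "upper_ahlfors \<nu> X Y \<upsilon>" "Q_continuous \<nu> X Y Z \<beta> (\<lambda>r. r powr min \<beta> s3)"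
    show "(SUP x\<in>X. SUP r\<in>{0<..<exp (- 1 / s3)}.
          ennreal (?I x r * (r powr \<beta> / max (r powr \<beta>) (r powr s3)))) < \<infinity>"
      by (rule main[OF iii]) (auto simp: powr_min)
    assume "\<beta> \<le> s3"
    then have eq: "min \<beta> s3 = \<beta>" by simp
    show "holder_b_space_eq (\<lambda>r. r powr min \<beta> s3) (\<lambda>r. r powr \<beta>) X"
      by (rule holder_b_space_eqI[where C = 1]) (auto simp: eq)
    show "(SUP x\<in>X. SUP r\<in>{0<..}. ennreal (?I x r)) < \<infinity>"
      by (rule star[OF iii, of 1]) (auto simp: eq)
  }
qed

end
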